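(* Consider a constrained block circulant QP of order $n$, $$\text{(O)}\qquad \min_{z,v}\ \tfrac12 z^TJz+q^Tz\quad\text{s.t. } Kz-v=0,\ \ \underline v\le v\le\bar v,$$ with segments parameters $N_z,N_v$, $l_z^1,\dots,l_z^{N_z}$, $l_v^1,\dots,l_v^{N_v}$ (as in the context). For $j\in\{z,v\}$ let $\psi_j=\mathrm{diag}\{F_n\otimes I_{l_j^1},\dots,F_n\otimes I_{l_j^{N_j}}\}$ (block diagonal), and set $\tilde q=\psi_z^Hq$, $\tilde J=\psi_z^HJ\psi_z$, $\tilde K=\psi_v^HK\psi_z$. Consider the problem $$\text{(D)}\qquad \min_{\tilde z\in\mathcal S_z,\ \tilde v\in\mathcal S_v}\ \tfrac12\tilde z^H\tilde J\tilde z+\tilde q^H\tilde z\quad\text{s.t. } \tilde K\tilde z-\tilde v=0,\ \ \underline v\le\psi_v\tilde v\le\bar v,$$ where $\mathcal S_z,\mathcal S_v$ are the sets of complex vectors each of whose segments has the pattern of complex conjugates (as in the context). Then (D) is equivalent to (O) in the sense that $$z^*=\psi_z\tilde z^*,\quad v^*=\psi_v\tilde v^*,\quad \gamma^*=\psi_v\tilde\gamma^*,\quad \bar\lambda^*=\tilde{\bar\lambda}^*,\quad \underline\lambda^*=\tilde{\underline\lambda}^*,$$ where $(z,v,\gamma,\bar\lambda,\underline\lambda)^*$ and $(\tilde z,\tilde v,\tilde\gamma,\tilde{\bar\lambda},\tilde{\underline\lambda})^*$ are primal and dual optimizers of (O) and (D), respectively; that is, these relations put the primal-dual optimizers of (D)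 and of (O) in one-to-one correspondence.
   Context: $M^H$ denotes the Hermitian transpose, $\otimes$ the Kronecker product. Fourier matrix: $F_n=\frac1{\sqrt n}[w_0\;\dots\; w_{n-1}]\in\mathbb C^{n\times n}$ with columns $w_j=(1,\rho_j,\dots,\rho_j^{n-1})^T$, $\rho_j=e^{2\pi ij/n}$. $\mathcal{BC}(n,p,m)\subseteq\mathbb R^{np\times nm}$ is the set of real block circulant matrices: $n\times n$ block matrices with $p\times m$ blocks whose $(r,s)$ block is $b_{(s-r)\bmod n}$ for some $b_0,\dots,b_{n-1}\in\mathbb R^{p\times m}$. Constrained block circulant QP (CBCQP) of order $n$: a real constrained QP of the form (O) for which $z$ and $v$ can be partitioned into $N_z$ and $N_v$ segments, of lengths $nl_z^1,\dots,nl_z^{N_z}$ and $nl_v^1,\dots,nl_v^{N_v}$, such that in the induced partitions $J=(J_{kj})$, $K=(K_{wj})$ all blocks are block circulant of order $n$: $J_{kj}\in\mathcal{BC}(n,l_z^k,l_z^j)$, $K_{wj}\in\mathcal{BC}(n,l_v^w,l_z^j)$ for $k,j=1,\dots,N_z$, $w=1,\dots,N_v$. Pattern of complex conjugates: a segment $s=(s_0,\dots,s_{n-1})$ with blocks $s_i\in\mathbb C^{l}$ has the pattern if $s_0$ is real and $s_i=\overline{s_{n-i}}$ for $i=1,\dots,n-1$ (so $s_{n/2}$ is real when $n$ is even). $\mathcal S_z$ (resp. $\mathcal S_v$) is the set of vectors in $\mathbb C^{n\sum_k l_z^k}$ (resp. $\mathbb C^{n\sum_w l_v^w}$) all of whose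 segments have this pattern. Primal and dual optimizers are saddle points (minimizing over primal variables, maximizing over dual variables with the inequality multipliers $\ge0$) of the augmented Lagrangians, with fixed penalty parameter $\rho>0$ (not to be confused with the roots of unity $\rho_j$): for (O), over real $z,v,\gamma$ and $\underline\lambda,\bar\lambda\ge0$, $$L=\tfrac12z^TJz+q^Tz+\tfrac\rho2\|Kz-v\|_2^2+\gamma^T(Kz-v)+\underline\lambda^T(-v+\underline v)+\bar\lambda^T(v-\bar v);$$ for (D), over $\tilde z\in\mathcal S_z$, $\tilde v\in\mathcal S_v$, $\tilde\gamma\in\mathcal S_v$ and real $\tilde{\underline\lambda},\tilde{\bar\lambda}\ge0$, $$\tilde L=\tfrac12\tilde z^H\tilde J\tilde z+\tilde q^H\tilde z+\tfrac\rho2\|\tilde K\tilde z-\tilde v\|_2^2+\tilde\gamma^H(\tilde K\tilde z-\tilde v)+\tilde{\underline\lambda}^T(-\psi_v\tilde v+\underline v)+\tilde{\bar\lambda}^T(\psi_v\tilde v-\bar v).$$ *)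

theory Defs
  imports Complex_Main "Jordan_Normal_Form.Schur_Decomposition"
begin

definition fourier_mat :: "nat \<Rightarrow> complex mat" where
  "fourier_mat n = mat n n (\<lambda>(i, j).
     (1 / complex_of_real (sqrt (real n))) *
       exp (2 * complex_of_real pi * \<i> * of_nat j / of_nat n) ^ i)"

definition kronecker :: "'a :: times mat \<Rightarrow> 'a mat \<Rightarrow> 'a mat" where
  "kronecker A B = mat (dim_row A * dim_row B) (dim_col A * dim_col B) (\<lambda>(i, j).
     A $$ (i div dim_row B, j div dim_col B) * B $$ (i mod dim_row B, j mod dim_col B))"

definition block_fourier :: "nat \<Rightarrow> nat list \<Rightarrow> complex mat" where
  "block_fourier n ls = diag_block_mat (map (\<lambda>l. kronecker (fourier_mat n) (1\<^sub>m l)) ls)"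

text \<open>Contiguous blocks of a matrix or vector, given by offsets and sizes.\<close>

definition mat_block :: "'a mat \<Rightarrow> nat \<Rightarrow> nat \<Rightarrow> nat \<Rightarrow> nat \<Rightarrow> 'a mat" where
  "mat_block A i0 j0 p m = mat p m (\<lambda>(i, j). A $$ (i0 + i, j0 + j))"

definition vec_block :: "'a vec \<Rightarrow> nat \<Rightarrow> nat \<Rightarrow> 'a vec" where
  "vec_block x i0 p = vec p (\<lambda>i. x $ (i0 + i))"

definition block_circulant :: "nat \<Rightarrow> nat \<Rightarrow> nat \<Rightarrow> real mat set" where
  "block_circulant n p m = {B \<in> carrier_mat (n * p) (n * m).
     \<exists>b. (\<forall>i<n. b i \<in> carrier_mat p m) \<and>
         (\<forall>r<n. \<forall>s<n. mat_block B (r * p) (s * m) p m = b (nat ((int s - int r) mod int n)))}"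

text \<open>A list \<open>ls\<close> of segment lengths partitions \<open>{0..<n * sum_list ls}\<close> into segments, the
  \<open>k\<close>-th (counting from 0) having length \<open>n * ls ! k\<close> and the following offset.\<close>

definition seg_offset :: "nat \<Rightarrow> nat list \<Rightarrow> nat \<Rightarrow> nat" where
  "seg_offset n ls k = n * sum_list (take k ls)"

definition segwise_block_circulant :: "nat \<Rightarrow> nat list \<Rightarrow> nat list \<Rightarrow> real mat \<Rightarrow> bool" where
  "segwise_block_circulant n ls ms A \<longleftrightarrow>
     A \<in> carrier_mat (n * sum_list ls) (n * sum_list ms) \<and>
     (\<forall>k<length ls. \<forall>j<length ms.
        mat_block A (seg_offset n ls k) (seg_offset n ms j) (n * ls ! k) (n * ms ! j)
          \<in> block_circulant n (ls ! k) (ms ! j))"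

text \<open>Data of the problem: minimize \<open>1/2 z\<^sup>T J z + q\<^sup>T z\<close> subject to
  \<open>K z - v = 0\<close> and \<open>vl \<le> v \<le> vu\<close>.\<close>

definition cbcqp ::
  "nat \<Rightarrow> nat list \<Rightarrow> nat list \<Rightarrow> real mat \<Rightarrow> real vec \<Rightarrow> real mat \<Rightarrow> real vec \<Rightarrow> real vec \<Rightarrow> bool" where
  "cbcqp n lz lv J q K vl vu \<longleftrightarrow>
     n > 0 \<and>
     segwise_block_circulant n lz lz J \<and>
     q \<in> carrier_vec (n * sum_list lz) \<and>
     segwise_block_circulant n lv lz K \<and>
     vl \<in> carrier_vec (n * sum_list lv) \<and>
     vu \<in> carrier_vec (n * sum_list lv)"

definition conj_pattern :: "nat \<Rightarrow> nat \<Rightarrow> complex vec \<Rightarrow> bool" where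
  "conj_pattern n l s \<longleftrightarrow>
     (\<forall>a<l. vec_block s 0 l $ a \<in> \<real>) \<and>
     (\<forall>i\<in>{1..n - 1}. vec_block s (i * l) l = conjugate (vec_block s ((n - i) * l) l))"

definition conj_pattern_vecs :: "nat \<Rightarrow> nat list \<Rightarrow> complex vec set" where
  "conj_pattern_vecs n ls = {s \<in> carrier_vec (n * sum_list ls).
     \<forall>k<length ls. conj_pattern n (ls ! k) (vec_block s (seg_offset n ls k) (n * ls ! k))}"

abbreviation cvec :: "real vec \<Rightarrow> complex vec" where
  "cvec \<equiv> map_vec complex_of_real"

abbreviation cmat :: "real mat \<Rightarrow> complex mat" where
  "cmat \<equiv> map_mat complex_of_real"

definition sq_norm2 :: "'a :: real_normed_vector vec \<Rightarrow> real" where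
  "sq_norm2 x = (\<Sum>i<dim_vec x. (norm (x $ i))\<^sup>2)"

definition qp_objective :: "real mat \<Rightarrow> real vec \<Rightarrow> real vec \<Rightarrow> real" where
  "qp_objective J q z = 1 / 2 * (z \<bullet> (J *\<^sub>v z)) + q \<bullet> z"

text \<open>Augmented Lagrangian; the dual variables are the multiplier \<open>g\<close> of the equality constraint
  and the multipliers \<open>ml\<close>, \<open>mu\<close> of the lower and upper bounds.\<close>

definition aug_lagrangian ::
  "real \<Rightarrow> real mat \<Rightarrow> real vec \<Rightarrow> real mat \<Rightarrow> real vec \<Rightarrow> real vec \<Rightarrow>
   real vec \<times> real vec \<Rightarrow> real vec \<times> real vec \<times> real vec \<Rightarrow> real" where
  "aug_lagrangian \<rho> J q K vl vu = (\<lambda>(z, v) (g, ml, mu).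
     qp_objective J q z
     + \<rho> / 2 * sq_norm2 (K *\<^sub>v z - v)
     + g \<bullet> (K *\<^sub>v z - v)
     + ml \<bullet> (- v + vl)
     + mu \<bullet> (v - vu))"

text \<open>For complex vectors, \<open>conjugate x \<bullet> y\<close> is \<open>x\<^sup>H y\<close>.\<close>

definition qp_objective_D :: "complex mat \<Rightarrow> complex vec \<Rightarrow> complex vec \<Rightarrow> complex" where
  "qp_objective_D J q z = 1 / 2 * (conjugate z \<bullet> (J *\<^sub>v z)) + conjugate q \<bullet> z"

definition aug_lagrangian_D ::
  "real \<Rightarrow> complex mat \<Rightarrow> complex mat \<Rightarrow> complex vec \<Rightarrow> complex mat \<Rightarrow> real vec \<Rightarrow> real vec \<Rightarrow>
   complex vec \<times> complex vec \<Rightarrow> complex vec \<times> real vec \<times> real vec \<Rightarrow> complex" where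
  "aug_lagrangian_D \<rho> \<psi>v J q K vl vu = (\<lambda>(z, v) (g, ml, mu).
     qp_objective_D J q z
     + complex_of_real (\<rho> / 2 * sq_norm2 (K *\<^sub>v z - v))
     + conjugate g \<bullet> (K *\<^sub>v z - v)
     + cvec ml \<bullet> (- (\<psi>v *\<^sub>v v) + cvec vl)
     + cvec mu \<bullet> (\<psi>v *\<^sub>v v - cvec vu))"

text \<open>Saddle points of \<open>L\<close>, minimizing over \<open>P\<close> and maximizing over \<open>Q\<close>. For complex-valued \<open>L\<close>,
  \<open>x \<le> y\<close> means \<open>Re x \<le> Re y \<and> Im x = Im y\<close>, so that no imaginary part is ignored.\<close>

definition saddle_points :: "'p set \<Rightarrow> 'd set \<Rightarrow> ('p \<Rightarrow> 'd \<Rightarrow> 'r :: order) \<Rightarrow> ('p \<times> 'd) set" where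
  "saddle_points P Q L = {(x, y). x \<in> P \<and> y \<in> Q \<and>
     (\<forall>x'\<in>P. L x y \<le> L x' y) \<and> (\<forall>y'\<in>Q. L x y' \<le> L x y)}"

definition nonneg_vecs :: "nat \<Rightarrow> real vec set" where
  "nonneg_vecs d = {x \<in> carrier_vec d. 0\<^sub>v d \<le> x}"

definition optimizers_O ::
  "nat \<Rightarrow> nat list \<Rightarrow> nat list \<Rightarrow> real \<Rightarrow>
   real mat \<Rightarrow> real vec \<Rightarrow> real mat \<Rightarrow> real vec \<Rightarrow> real vec \<Rightarrow>
   ((real vec \<times> real vec) \<times> (real vec \<times> real vec \<times> real vec)) set" where
  "optimizers_O n lz lv \<rho> J q K vl vu =
     saddle_points
       (carrier_vec (n * sum_list lz) \<times> carrier_vec (n * sum_list lv))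
       (carrier_vec (n * sum_list lv) \<times>
          nonneg_vecs (n * sum_list lv) \<times> nonneg_vecs (n * sum_list lv))
       (aug_lagrangian \<rho> J q K vl vu)"

definition optimizers_D ::
  "nat \<Rightarrow> nat list \<Rightarrow> nat list \<Rightarrow> real \<Rightarrow> complex mat \<Rightarrow>
   complex mat \<Rightarrow> complex vec \<Rightarrow> complex mat \<Rightarrow> real vec \<Rightarrow> real vec \<Rightarrow>
   ((complex vec \<times> complex vec) \<times> (complex vec \<times> real vec \<times> real vec)) set" where
  "optimizers_D n lz lv \<rho> \<psi>v J q K vl vu =
     saddle_points
       (conj_pattern_vecs n lz \<times> conj_pattern_vecs n lv)
       (conj_pattern_vecs n lv \<times>
          nonneg_vecs (n * sum_list lv) \<times> nonneg_vecs (n * sum_list lv))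
       (aug_lagrangian_D \<rho> \<psi>v J q K vl vu)"

end

theory Submission
  imports Defs
begin

text \<open>
  The change of variables \<open>z = \<psi>\<^sub>z zt\<close> is an isometry that carries the conjugate-symmetric vectors
  exactly onto the real ones, so the two problems are the same saddle point problem written in two
  coordinate systems.

  Both halves of this come from a single Fourier matrix. Its columns are orthonormal by the
  geometric sum, and orthonormality survives the Kronecker product with an identity and the
  block diagonal sum, so \<open>\<psi>\<close> is unitary (\<open>block_fourier_unitary\<close>). For the reality statement
  (\<open>conj_pattern_vecs_iff_real\<close>), conjugating the Fourier matrix permutes its columns by
  \<open>k \<mapsto> -k mod n\<close>. Hence conjugating the transform of \<open>s\<close> gives the transform of the reflected
  conjugate of \<open>s\<close>. As the transform is injective, it is real precisely when \<open>s\<close> is its own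
  reflected conjugate, which is the pattern of complex conjugates.

  Unitarity makes the transformed matrices act as the original ones in the new coordinates
  (\<open>sandwich_mult_vec\<close>) and preserves inner products, so every term of the
  augmented Lagrangian of (D) equals the corresponding term of the one of (O) at the transformed
  point (\<open>aug_lagrangian_D_eq_aug_lagrangian\<close>). A bijective relabelling of the
  primal and dual variables under which the two functions agree, up to an order embedding of
  the values, matches their saddle points (\<open>bij_betw_saddle_points\<close>).
\<close>

section \<open>Adjoints and Kronecker products\<close>

lemma mat_adjoint_dim [simp]:
  "dim_row (mat_adjoint A) = dim_col A" "dim_col (mat_adjoint A) = dim_row A"
  by (simp_all add: mat_adjoint_def)

lemma mat_adjoint_carrier [simp]:
  "A \<in> carrier_mat m k \<Longrightarrow> mat_adjoint A \<in> carrier_mat k m"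
  by (auto intro: carrier_matI)

lemma mat_adjoint_index [simp]:
  assumes "i < dim_col A" "j < dim_row A"
  shows "mat_adjoint A $$ (i, j) = conjugate (A $$ (j, i))"
  using assms by (simp add: mat_adjoint_def mat_of_rows_index)

text \<open>The defining property of the adjoint, \<open>x\<^sup>H (A\<^sup>H y) = (A x)\<^sup>H y\<close>: interchange the two sums.\<close>

lemma conjugate_adjoint_scalar_prod:
  fixes A :: "complex mat"
  assumes A: "A \<in> carrier_mat m k" and x: "x \<in> carrier_vec k" and y: "y \<in> carrier_vec m"
  shows "conjugate x \<bullet> (mat_adjoint A *\<^sub>v y) = conjugate (A *\<^sub>v x) \<bullet> y"
proof -
  have "conjugate x \<bullet> (mat_adjoint A *\<^sub>v y)
      = (\<Sum>j<k. \<Sum>i<m. cnj (x $ j) * (cnj (A $$ (i, j)) * y $ i))"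
    using assms by (simp add: scalar_prod_def sum_distrib_left atLeast0LessThan)
  also have "\<dots> = (\<Sum>i<m. \<Sum>j<k. cnj (x $ j) * (cnj (A $$ (i, j)) * y $ i))"
    by (rule sum.swap)
  also have "\<dots> = conjugate (A *\<^sub>v x) \<bullet> y"
    using assms by (simp add: scalar_prod_def sum_distrib_left atLeast0LessThan mult_ac)
  finally show ?thesis .
qed

lemma kronecker_dim [simp]:
  "dim_row (kronecker A B) = dim_row A * dim_row B"
  "dim_col (kronecker A B) = dim_col A * dim_col B"
  by (simp_all add: kronecker_def)

lemma kronecker_index [simp]:
  assumes "i < dim_row A * dim_row B" "j < dim_col A * dim_col B"
  shows "kronecker A B $$ (i, j) =
    A $$ (i div dim_row B, j div dim_col B) * B $$ (i mod dim_row B, j mod dim_col B)"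
  using assms by (simp add: kronecker_def)

lemma div_mod_less_mult:
  fixes i m l :: nat
  assumes "i < m * l"
  shows "i div l < m" "i mod l < l"
  using assms by (simp add: less_mult_imp_div_less, cases "l = 0", simp_all)

text \<open>Splits a sum over the rows of a Kronecker product into the sum over its block indices and the
  sum over the positions within a block.\<close>

lemma sum_lessThan_mult:
  fixes h :: "nat \<Rightarrow> 'a :: comm_monoid_add"
  shows "sum h {..<m * l} = (\<Sum>a<m. \<Sum>b<l. h (a * l + b))"
proof -
  have "sum h {..<m * l} = (\<Sum>a<m. sum h {a * l..<a * l + l})"
    by (rule sum.nat_group[symmetric])
  also have "\<dots> = (\<Sum>a<m. \<Sum>b<l. h (a * l + b))"
    by (simp add: sum.shift_bounds_nat_ivl[of h 0, simplified] add.commute atLeast0LessThan)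
  finally show ?thesis .
qed

text \<open>The mixed product rule: indexed by pairs (block, position in the block), an entry of the
  left-hand side is a double sum of products, which factors.\<close>

lemma kronecker_mult:
  fixes A B C D :: "'a :: comm_semiring_0 mat"
  assumes "dim_col A = dim_row C" "dim_col B = dim_row D"
  shows "kronecker A B * kronecker C D = kronecker (A * C) (B * D)"
proof (rule eq_matI)
  fix i j
  assume "i < dim_row (kronecker (A * C) (B * D))" "j < dim_col (kronecker (A * C) (B * D))"
  then have i: "i < dim_row A * dim_row B" and j: "j < dim_col C * dim_col D"
    by auto
  note im = div_mod_less_mult[OF i] and jm = div_mod_less_mult[OF j]
  have lt: "a * dim_row D + b < dim_row C * dim_row D" if "a < dim_row C" "b < dim_row D" for a b
  proof -
    have "a * dim_row D + b < Suc a * dim_row D" using that by simp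
    also have "\<dots> \<le> dim_row C * dim_row D" using that by (intro mult_le_mono1) simp
    finally show ?thesis .
  qed
  have "(kronecker A B * kronecker C D) $$ (i, j)
      = (\<Sum>k<dim_row C * dim_row D. kronecker A B $$ (i, k) * kronecker C D $$ (k, j))"
    using i j assms by (simp add: scalar_prod_def atLeast0LessThan)
  also have "\<dots> = (\<Sum>a<dim_row C. \<Sum>b<dim_row D.
      (A $$ (i div dim_row B, a) * B $$ (i mod dim_row B, b)) *
      (C $$ (a, j div dim_col D) * D $$ (b, j mod dim_col D)))"
    unfolding sum_lessThan_mult
    using i j assms lt by (intro sum.cong refl) simp
  also have "\<dots> = (A * C) $$ (i div dim_row B, j div dim_col D)
      * (B * D) $$ (i mod dim_row B, j mod dim_col D)"
    using im jm assms by (simp add: scalar_prod_def sum_product atLeast0LessThan mult_ac)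
  also have "\<dots> = kronecker (A * C) (B * D) $$ (i, j)"
    using i j by simp
  finally show "(kronecker A B * kronecker C D) $$ (i, j) = kronecker (A * C) (B * D) $$ (i, j)" .
qed simp_all

lemma kronecker_one: "kronecker (1\<^sub>m m) (1\<^sub>m l) = (1\<^sub>m (m * l) :: 'a :: semiring_1 mat)"
proof (rule eq_matI)
  fix i j
  assume "i < dim_row (1\<^sub>m (m * l) :: 'a mat)" "j < dim_col (1\<^sub>m (m * l) :: 'a mat)"
  then have i: "i < m * l" and j: "j < m * l" by auto
  have "i = j" if "i div l = j div l" "i mod l = j mod l"
    using that by (metis div_mult_mod_eq)
  then show "kronecker (1\<^sub>m m) (1\<^sub>m l) $$ (i, j) = (1\<^sub>m (m * l) :: 'a mat) $$ (i, j)"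
    using i j div_mod_less_mult[OF i] div_mod_less_mult[OF j] by auto
qed simp_all

lemma mat_adjoint_kronecker:
  fixes A B :: "complex mat"
  shows "mat_adjoint (kronecker A B) = kronecker (mat_adjoint A) (mat_adjoint B)"
proof (rule eq_matI)
  fix i j
  assume "i < dim_row (kronecker (mat_adjoint A) (mat_adjoint B))"
    "j < dim_col (kronecker (mat_adjoint A) (mat_adjoint B))"
  then have i: "i < dim_col A * dim_col B" and j: "j < dim_row A * dim_row B"
    by auto
  then show "mat_adjoint (kronecker A B) $$ (i, j)
      = kronecker (mat_adjoint A) (mat_adjoint B) $$ (i, j)"
    using div_mod_less_mult[OF i] div_mod_less_mult[OF j] by simp
qed simp_all

lemma mat_adjoint_one: "mat_adjoint (1\<^sub>m l :: complex mat) = 1\<^sub>m l"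
  by (rule eq_matI) auto

section \<open>The block Fourier matrix is unitary\<close>

abbreviation root_of_unity :: "nat \<Rightarrow> nat \<Rightarrow> complex" where
  "root_of_unity n j \<equiv> exp (2 * complex_of_real pi * \<i> * of_nat j / of_nat n)"

lemma root_of_unity_eq_cis: "root_of_unity n j = cis (2 * pi * real j / real n)"
  by (simp add: cis_conv_exp mult_ac)

lemma fourier_dim [simp]: "dim_row (fourier_mat n) = n" "dim_col (fourier_mat n) = n"
  by (simp_all add: fourier_mat_def)

lemma fourier_index:
  "i < n \<Longrightarrow> j < n \<Longrightarrow>
    fourier_mat n $$ (i, j) = 1 / complex_of_real (sqrt (real n)) * root_of_unity n j ^ i"
  by (simp add: fourier_mat_def)

text \<open>The product of the two entries in row \<open>i\<close> is \<open>w\<^sup>i / n\<close> with \<open>w = \<rho>\<^sub>k / \<rho>\<^sub>j\<close>. This is an \<open>n\<close>-th root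
  of unity, and it differs from 1 when \<open>j \<noteq> k\<close>; the geometric sum then vanishes.\<close>

lemma fourier_columns_orthonormal:
  assumes "j < n" "k < n"
  shows "(\<Sum>i<n. cnj (fourier_mat n $$ (i, j)) * fourier_mat n $$ (i, k)) = (if j = k then 1 else 0)"
proof -
  define w where "w = cis (2 * pi * (real k - real j) / real n)"
  have n: "n > 0" using assms by simp
  have w: "cnj (root_of_unity n j) * root_of_unity n k = w"
    unfolding root_of_unity_eq_cis w_def cis_cnj cis_mult
    by (rule arg_cong[where f = cis]) (simp only: diff_divide_distrib right_diff_distrib)
  have "(\<Sum>i<n. cnj (fourier_mat n $$ (i, j)) * fourier_mat n $$ (i, k)) = (\<Sum>i<n. 1 / of_nat n * w ^ i)"
  proof (rule sum.cong[OF refl])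
    fix i assume "i \<in> {..<n}"
    then have "cnj (fourier_mat n $$ (i, j)) * fourier_mat n $$ (i, k)
       = 1 / (complex_of_real (sqrt (real n)) * complex_of_real (sqrt (real n)))
          * (cnj (root_of_unity n j) * root_of_unity n k) ^ i"
      using assms by (simp add: fourier_index power_mult_distrib del: of_real_mult)
    also have "complex_of_real (sqrt (real n)) * complex_of_real (sqrt (real n)) = of_nat n"
      by (simp flip: of_real_mult)
    finally show "cnj (fourier_mat n $$ (i, j)) * fourier_mat n $$ (i, k) = 1 / of_nat n * w ^ i"
      by (simp only: w)
  qed
  also have "\<dots> = 1 / of_nat n * (\<Sum>i<n. w ^ i)"
    by (rule sum_distrib_left[symmetric])
  also have "\<dots> = (if j = k then 1 else 0)"
  proof (cases "j = k")
    case True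
    then show ?thesis using n by (simp add: w_def)
  next
    case False
    have "w ^ n = cis (2 * pi * (real k - real j))"
      using n by (simp add: w_def DeMoivre)
    also have "\<dots> = 1"
      using cis_multiple_2pi[of "real k - real j"] by simp
    finally have wn: "w ^ n = 1" .
    \<comment> \<open>Otherwise \<open>n\<close> would divide \<open>k - j\<close>, whose absolute value is less than \<open>n\<close>.\<close>
    have "w \<noteq> 1"
    proof
      assume "w = 1"
      then have "cos (2 * pi * (real k - real j) / real n) = 1"
        by (metis Re_complex_of_real cis.simps(1) of_real_1 w_def)
      then obtain m :: int where m: "2 * pi * (real k - real j) / real n = m * (2 * pi)"
        by (auto simp: cos_one_2pi_int)
      have "real k - real j = 2 * pi * (real k - real j) / real n * (real n / (2 * pi))"
        using n by simp
      also have "\<dots> = of_int m * real n"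
        unfolding m by simp
      finally have "real k - real j = of_int m * real n" .
      then have *: "int k - int j = m * int n"
        by (metis (mono_tags) of_int_diff of_int_eq_iff of_int_mult of_int_of_nat_eq)
      then have "int n dvd int k - int j" by simp
      moreover have "\<bar>int k - int j\<bar> < int n" using assms by linarith
      ultimately have "int k - int j = 0"
        using dvd_imp_le_int[of "int k - int j" "int n"] by linarith
      then show False using False by simp
    qed
    then show ?thesis using False wn by (simp add: geometric_sum)
  qed
  finally show ?thesis .
qed

lemma fourier_unitary: "mat_adjoint (fourier_mat n) * fourier_mat n = 1\<^sub>m n"
  by (rule eq_matI)
    (simp_all add: scalar_prod_def atLeast0LessThan fourier_columns_orthonormal)

abbreviation segment_fourier :: "nat \<Rightarrow> nat \<Rightarrow> complex mat" where
  "segment_fourier n l \<equiv> kronecker (fourier_mat n) (1\<^sub>m l)"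

lemma segment_fourier_unitary:
  "mat_adjoint (segment_fourier n l) * segment_fourier n l = 1\<^sub>m (n * l)"
  by (simp add: mat_adjoint_kronecker mat_adjoint_one kronecker_mult fourier_unitary kronecker_one)

lemma block_fourier_Nil: "block_fourier n [] = 0\<^sub>m 0 0"
  by (simp add: block_fourier_def)

lemma block_fourier_carrier [simp]:
  "block_fourier n ls \<in> carrier_mat (n * sum_list ls) (n * sum_list ls)"
proof (induction ls)
  case (Cons l ls)
  then show ?case
    by (intro carrier_matI) (auto simp: block_fourier_def Let_def distrib_left)
qed (simp add: block_fourier_Nil)

lemma block_fourier_dim [simp]:
  "dim_row (block_fourier n ls) = n * sum_list ls" "dim_col (block_fourier n ls) = n * sum_list ls"
  using block_fourier_carrier[of n ls] by (blast dest: carrier_matD)+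

lemma block_fourier_Cons:
  "block_fourier n (l # ls) =
    four_block_mat (segment_fourier n l) (0\<^sub>m (n * l) (n * sum_list ls))
      (0\<^sub>m (n * sum_list ls) (n * l)) (block_fourier n ls)"
  using block_fourier_dim[of n ls, unfolded block_fourier_def]
  by (simp add: block_fourier_def Let_def)

lemma mat_adjoint_four_block_diag:
  fixes A D :: "complex mat"
  assumes "A \<in> carrier_mat m m" "D \<in> carrier_mat k k"
  shows "mat_adjoint (four_block_mat A (0\<^sub>m m k) (0\<^sub>m k m) D)
    = four_block_mat (mat_adjoint A) (0\<^sub>m m k) (0\<^sub>m k m) (mat_adjoint D)"
  using assms by (intro eq_matI) auto

text \<open>Induction over the segments: the matrix is block diagonal with unitary diagonal blocks.\<close>

lemma block_fourier_unitary:
  "mat_adjoint (block_fourier n ls) * block_fourier n ls = 1\<^sub>m (n * sum_list ls)"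
proof (induction ls)
  case Nil
  show ?case by (rule eq_matI) auto
next
  case (Cons l ls)
  have S: "segment_fourier n l \<in> carrier_mat (n * l) (n * l)" by (intro carrier_matI) auto
  have "mat_adjoint (block_fourier n (l # ls)) * block_fourier n (l # ls)
     = four_block_mat (1\<^sub>m (n * l)) (0\<^sub>m (n * l) (n * sum_list ls))
        (0\<^sub>m (n * sum_list ls) (n * l)) (1\<^sub>m (n * sum_list ls))"
    unfolding block_fourier_Cons mat_adjoint_four_block_diag[OF S block_fourier_carrier]
    by (subst mult_four_block_mat[where ?nr1.0 = "n * l" and ?n1.0 = "n * l"
          and ?n2.0 = "n * sum_list ls" and ?nr2.0 = "n * sum_list ls"
          and ?nc1.0 = "n * l" and ?nc2.0 = "n * sum_list ls"])
      (use S in \<open>auto simp: segment_fourier_unitary Cons.IH\<close>)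
  also have "\<dots> = 1\<^sub>m (n * sum_list (l # ls))"
    by (rule eq_matI) (auto simp: distrib_left)
  finally show ?case .
qed

lemma block_fourier_unitary':
  "block_fourier n ls * mat_adjoint (block_fourier n ls) = 1\<^sub>m (n * sum_list ls)"
  using block_fourier_unitary by (rule mat_mult_left_right_inverse[rotated -1]) auto

lemma block_fourier_inverse:
  assumes "s \<in> carrier_vec (n * sum_list ls)"
  shows "mat_adjoint (block_fourier n ls) *\<^sub>v (block_fourier n ls *\<^sub>v s) = s"
    and "block_fourier n ls *\<^sub>v (mat_adjoint (block_fourier n ls) *\<^sub>v s) = s"
  using assms
  by (subst assoc_mult_mat_vec[symmetric];
      auto simp: block_fourier_unitary block_fourier_unitary')+

section \<open>Conjugate symmetry as reality of the transform\<close>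

text \<open>The index \<open>-k\<close> modulo \<open>n\<close>; it fixes 0, which is why the pattern asks the block with index 0 to
  be real.\<close>

definition index_reflection :: "nat \<Rightarrow> nat \<Rightarrow> nat" where
  "index_reflection n k = (n - k) mod n"

lemma index_reflection_less: "n > 0 \<Longrightarrow> index_reflection n k < n"
  by (simp add: index_reflection_def)

lemma index_reflection_eq: "k < n \<Longrightarrow> index_reflection n k = (if k = 0 then 0 else n - k)"
  by (auto simp: index_reflection_def)

lemma index_reflection_involutive:
  "k < n \<Longrightarrow> index_reflection n (index_reflection n k) = k"
  by (auto simp: index_reflection_eq)

text \<open>Conjugating the root of unity \<open>\<rho>\<^sub>k\<close> gives \<open>\<rho>\<^sub>-\<^sub>k\<close>, so conjugation permutes the columns.\<close>

lemma cnj_fourier: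
  assumes "i < n" "k < n"
  shows "cnj (fourier_mat n $$ (i, k)) = fourier_mat n $$ (i, index_reflection n k)"
proof -
  have "cnj (root_of_unity n k) = root_of_unity n (index_reflection n k)"
  proof (cases "k = 0")
    case True
    then show ?thesis using assms by (simp add: index_reflection_eq)
  next
    case False
    have "root_of_unity n (n - k) = cis (2 * pi + - (2 * pi * real k / real n))"
      unfolding root_of_unity_eq_cis
      using assms by (intro arg_cong[where f = cis]) (simp add: field_simps of_nat_diff)
    also have "\<dots> = cnj (root_of_unity n k)"
      unfolding cis_mult[symmetric] by (simp add: root_of_unity_eq_cis cis_cnj)
    finally show ?thesis using False assms by (simp add: index_reflection_eq)
  qed
  then show ?thesis
    using assms index_reflection_less[of n k] by (simp add: fourier_index)
qed

text \<open>The reflection on a segment of \<open>n\<close> blocks of length \<open>l\<close>: block indices are negated modulo \<open>n\<close>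
  and positions within a block are kept.\<close>

definition segment_reflection :: "nat \<Rightarrow> nat \<Rightarrow> nat \<Rightarrow> nat" where
  "segment_reflection n l j = index_reflection n (j div l) * l + j mod l"

lemma segment_reflection_props:
  assumes "j < n * l"
  shows "segment_reflection n l j div l = index_reflection n (j div l)"
    and "segment_reflection n l j mod l = j mod l"
    and "segment_reflection n l j < n * l"
    and "segment_reflection n l (segment_reflection n l j) = j"
proof -
  have l: "l > 0" and n: "n > 0" using assms by (auto intro: gr0I)
  show d: "segment_reflection n l j div l = index_reflection n (j div l)"
    and m: "segment_reflection n l j mod l = j mod l"
    using l by (simp_all add: segment_reflection_def)
  have "segment_reflection n l j < Suc (index_reflection n (j div l)) * l"
    using l by (simp add: segment_reflection_def)
  also have "\<dots> \<le> n * l"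
    using index_reflection_less[OF n] by (intro mult_le_mono1) (simp add: Suc_le_eq)
  finally show "segment_reflection n l j < n * l" .
  show "segment_reflection n l (segment_reflection n l j) = j"
    unfolding segment_reflection_def[of n l "segment_reflection n l j"] d m
    using index_reflection_involutive[OF div_mod_less_mult(1)[OF assms]] by simp
qed

lemma segment_fourier_carrier [simp]: "segment_fourier n l \<in> carrier_mat (n * l) (n * l)"
  by (intro carrier_matI) auto

lemma cnj_segment_fourier:
  assumes "i < n * l" "j < n * l"
  shows "cnj (segment_fourier n l $$ (i, j)) = segment_fourier n l $$ (i, segment_reflection n l j)"
  using assms div_mod_less_mult[OF assms(1)] div_mod_less_mult[OF assms(2)]
  by (simp add: segment_reflection_props cnj_fourier)

text \<open>One symmetry condition covers both clauses of the pattern: on block 0, a fixed point of the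
  reflection, it says that the entries are real, and on the other blocks it pairs \<open>i\<close> with \<open>n - i\<close>.\<close>

lemma conj_pattern_iff_reflection:
  assumes "s \<in> carrier_vec (n * l)" "n > 0"
  shows "conj_pattern n l s \<longleftrightarrow> (\<forall>j<n * l. s $ j = cnj (s $ segment_reflection n l j))"
    (is "_ \<longleftrightarrow> ?R")
proof
  assume p: "conj_pattern n l s"
  show ?R
  proof (intro allI impI)
    fix j assume j: "j < n * l"
    note dm = div_mod_less_mult[OF j]
    show "s $ j = cnj (s $ segment_reflection n l j)"
    proof (cases "j div l = 0")
      case True
      then have jl: "j < l" using dm(2) by (simp add: div_eq_0_iff)
      then have "vec_block s 0 l $ j \<in> \<real>"
        using p by (simp add: conj_pattern_def)
      then show ?thesis
        using jl assms by (simp add: vec_block_def segment_reflection_def index_reflection_eq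
            Reals_cnj_iff)
    next
      case False
      then have "vec_block s (j div l * l) l = conjugate (vec_block s ((n - j div l) * l) l)"
        using p dm by (simp add: conj_pattern_def)
      then have "vec_block s (j div l * l) l $ (j mod l)
         = conjugate (vec_block s ((n - j div l) * l) l) $ (j mod l)"
        by (rule arg_cong)
      then show ?thesis
        using dm False by (simp add: vec_block_def segment_reflection_def index_reflection_eq)
    qed
  qed
next
  assume R: ?R
  show "conj_pattern n l s"
    unfolding conj_pattern_def
  proof (intro conjI allI impI ballI)
    fix a assume a: "a < l"
    also have "l \<le> n * l" using assms by simp
    finally have "s $ a = cnj (s $ segment_reflection n l a)" using R by blast
    then show "vec_block s 0 l $ a \<in> \<real>"
      using a assms by (simp add: vec_block_def segment_reflection_def index_reflection_eq
          Reals_cnj_iff)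
  next
    fix i assume i: "i \<in> {1..n - 1}"
    show "vec_block s (i * l) l = conjugate (vec_block s ((n - i) * l) l)"
    proof (rule eq_vecI)
      fix a assume "a < dim_vec (conjugate (vec_block s ((n - i) * l) l))"
      then have a: "a < l" by (simp add: vec_block_def)
      then have "i * l + a < Suc i * l" by simp
      also have "\<dots> \<le> n * l" using i by (intro mult_le_mono1) auto
      finally have "s $ (i * l + a) = cnj (s $ segment_reflection n l (i * l + a))"
        using R by blast
      moreover have "segment_reflection n l (i * l + a) = (n - i) * l + a"
        using a i assms(2) by (auto simp: segment_reflection_def index_reflection_eq)
      ultimately show "vec_block s (i * l) l $ a = conjugate (vec_block s ((n - i) * l) l) $ a"
        using a by (simp add: vec_block_def)
    qed (simp add: vec_block_def)
  qed
qed

definition real_vec :: "complex vec \<Rightarrow> bool" where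
  "real_vec x \<longleftrightarrow> conjugate x = x"

lemma real_vec_iff: "real_vec x \<longleftrightarrow> cvec (map_vec Re x) = x"
  by (auto simp: real_vec_def vec_eq_iff complex_eq_iff)

lemma real_vec_cvec: "real_vec (cvec x)"
  by (auto simp: real_vec_def vec_eq_iff)

lemma real_vec_append: "real_vec (x @\<^sub>v y) \<longleftrightarrow> real_vec x \<and> real_vec y"
proof -
  have "conjugate (x @\<^sub>v y) = conjugate x @\<^sub>v conjugate y"
    by (rule eq_vecI) auto
  then show ?thesis
    unfolding real_vec_def
    by (metis append_vec_eq carrier_vec_conjugate carrier_vec_dim_vec)
qed

text \<open>With \<open>r\<close> the reflected conjugate of \<open>s\<close>, the conjugate of \<open>U s\<close> is \<open>U r\<close>. So \<open>U s\<close> is real iff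
  \<open>U r = U s\<close>, and by injectivity of \<open>U\<close> iff \<open>r = s\<close>.\<close>

lemma conj_pattern_iff_real_segment:
  assumes s: "s \<in> carrier_vec (n * l)" and n: "n > 0"
  shows "conj_pattern n l s \<longleftrightarrow> real_vec (segment_fourier n l *\<^sub>v s)"
proof -
  let ?U = "segment_fourier n l"
  define r where "r = vec (n * l) (\<lambda>j. cnj (s $ segment_reflection n l j))"
  have r: "r \<in> carrier_vec (n * l)" by (simp add: r_def)
  have refl: "conjugate (?U *\<^sub>v s) = ?U *\<^sub>v r"
  proof (rule eq_vecI)
    fix i assume "i < dim_vec (?U *\<^sub>v r)"
    then have i: "i < n * l" by simp
    have "conjugate (?U *\<^sub>v s) $ i = (\<Sum>j<n * l. cnj (?U $$ (i, j)) * cnj (s $ j))"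
      using i s by (simp add: scalar_prod_def atLeast0LessThan)
    also have "\<dots> = (\<Sum>j<n * l. ?U $$ (i, segment_reflection n l j) * cnj (s $ j))"
      using i by (intro sum.cong refl) (simp only: cnj_segment_fourier lessThan_iff)
    also have "\<dots> = (\<Sum>j<n * l. ?U $$ (i, j) * cnj (s $ segment_reflection n l j))"
      by (rule sum.reindex_bij_witness[where i = "segment_reflection n l"
            and j = "segment_reflection n l"])
        (simp_all only: segment_reflection_props lessThan_iff)
    also have "\<dots> = (?U *\<^sub>v r) $ i"
      using i by (simp add: scalar_prod_def atLeast0LessThan r_def)
    finally show "conjugate (?U *\<^sub>v s) $ i = (?U *\<^sub>v r) $ i" .
  qed simp
  have inv: "mat_adjoint ?U *\<^sub>v (?U *\<^sub>v x) = x" if "x \<in> carrier_vec (n * l)" for x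
    using assoc_mult_mat_vec[OF mat_adjoint_carrier[OF segment_fourier_carrier]
        segment_fourier_carrier that]
    unfolding segment_fourier_unitary one_mult_mat_vec[OF that] by (rule sym)
  have "real_vec (?U *\<^sub>v s) \<longleftrightarrow> ?U *\<^sub>v r = ?U *\<^sub>v s"
    by (simp add: real_vec_def refl)
  also have "\<dots> \<longleftrightarrow> r = s" using inv r s by metis
  also have "\<dots> \<longleftrightarrow> conj_pattern n l s"
    unfolding conj_pattern_iff_reflection[OF s n] using s by (auto simp: r_def vec_eq_iff)
  finally show ?thesis by simp
qed

lemma seg_offset_Suc: "seg_offset n (l # ls) (Suc k) = n * l + seg_offset n ls k"
  by (simp add: seg_offset_def distrib_left)

lemma seg_offset_bound:
  assumes "k < length ls"
  shows "seg_offset n ls k + n * ls ! k \<le> n * sum_list ls"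
proof -
  have "sum_list ls = sum_list (take (Suc k) ls) + sum_list (drop (Suc k) ls)"
    by (metis append_take_drop_id sum_list_append)
  then have "sum_list (take k ls) + ls ! k \<le> sum_list ls"
    using assms by (simp add: take_Suc_conv_app_nth)
  then show ?thesis
    unfolding seg_offset_def by (metis distrib_left mult_le_mono2)
qed

text \<open>Allows induction over the list of segments.\<close>

lemma conj_pattern_vecs_Cons:
  assumes s1: "s1 \<in> carrier_vec (n * l)" and s2: "s2 \<in> carrier_vec (n * sum_list ls)"
  shows "s1 @\<^sub>v s2 \<in> conj_pattern_vecs n (l # ls)
    \<longleftrightarrow> conj_pattern n l s1 \<and> s2 \<in> conj_pattern_vecs n ls"
proof -
  have 1: "vec_block (s1 @\<^sub>v s2) (seg_offset n (l # ls) 0) (n * l) = s1"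
    using s1 by (auto simp: vec_block_def seg_offset_def vec_eq_iff)
  have 2: "vec_block (s1 @\<^sub>v s2) (seg_offset n (l # ls) (Suc k)) (n * ls ! k)
      = vec_block s2 (seg_offset n ls k) (n * ls ! k)" if "k < length ls" for k
    using s1 s2 seg_offset_bound[OF that, of n]
    by (auto simp: vec_block_def seg_offset_Suc vec_eq_iff)
  have "s1 @\<^sub>v s2 \<in> carrier_vec (n * sum_list (l # ls))"
    using append_carrier_vec[OF s1 s2] by (simp add: distrib_left)
  then show ?thesis
    using s2 1 2 by (simp add: conj_pattern_vecs_def All_less_Suc2)
qed

lemma conj_pattern_vecs_iff_real:
  assumes "n > 0" "s \<in> carrier_vec (n * sum_list ls)"
  shows "s \<in> conj_pattern_vecs n ls \<longleftrightarrow> real_vec (block_fourier n ls *\<^sub>v s)"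
  using assms(2)
proof (induction ls arbitrary: s)
  case Nil
  then show ?case
    by (auto simp: conj_pattern_vecs_def real_vec_def vec_eq_iff)
next
  case (Cons l ls)
  have sc: "s \<in> carrier_vec (n * l + n * sum_list ls)"
    using Cons.prems by (simp add: distrib_left)
  define s1 s2 where "s1 = vec_first s (n * l)" and "s2 = vec_last s (n * sum_list ls)"
  have s12: "s1 \<in> carrier_vec (n * l)" "s2 \<in> carrier_vec (n * sum_list ls)"
    by (simp_all add: s1_def s2_def)
  have s: "s = s1 @\<^sub>v s2" using sc by (simp add: s1_def s2_def)
  have "block_fourier n (l # ls) *\<^sub>v s
      = segment_fourier n l *\<^sub>v s1 @\<^sub>v block_fourier n ls *\<^sub>v s2"
    unfolding block_fourier_Cons s
    by (rule mult_mat_vec_split) (use s12 in simp_all)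
  then show ?case
    unfolding s conj_pattern_vecs_Cons[OF s12] Cons.IH[OF s12(2)] real_vec_append[symmetric]
      conj_pattern_iff_real_segment[OF s12(1) assms(1)]
    by (simp add: real_vec_append)
qed

text \<open>On conjugate-symmetric vectors the transform is already real, and taking real parts only changes
  the type of its entries.\<close>

definition realification :: "nat \<Rightarrow> nat list \<Rightarrow> complex vec \<Rightarrow> real vec" where
  "realification n ls s = map_vec Re (block_fourier n ls *\<^sub>v s)"

lemma cvec_realification:
  assumes "n > 0" "s \<in> conj_pattern_vecs n ls"
  shows "cvec (realification n ls s) = block_fourier n ls *\<^sub>v s"
proof -
  have "s \<in> carrier_vec (n * sum_list ls)" using assms by (simp add: conj_pattern_vecs_def)
  then show ?thesis
    using assms conj_pattern_vecs_iff_real unfolding realification_def real_vec_iff by blast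
qed

text \<open>The inverse is the adjoint transform, by unitarity; it lands in the conjugate-symmetric vectors
  since its argument, a real vector, is the transform of its value.\<close>

lemma bij_betw_realification:
  assumes n: "n > 0"
  shows "bij_betw (realification n ls) (conj_pattern_vecs n ls) (carrier_vec (n * sum_list ls))"
proof (rule bij_betw_byWitness[where f' = "\<lambda>x. mat_adjoint (block_fourier n ls) *\<^sub>v cvec x"])
  let ?U = "block_fourier n ls"
  have Re: "map_vec Re (cvec x) = x" for x by (simp add: vec_eq_iff)
  have sub: "s \<in> carrier_vec (n * sum_list ls)" if "s \<in> conj_pattern_vecs n ls" for s
    using that by (simp add: conj_pattern_vecs_def)
  show "\<forall>s\<in>conj_pattern_vecs n ls. mat_adjoint ?U *\<^sub>v cvec (realification n ls s) = s"
    using n sub by (simp add: cvec_realification block_fourier_inverse)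
  show "\<forall>x\<in>carrier_vec (n * sum_list ls). realification n ls (mat_adjoint ?U *\<^sub>v cvec x) = x"
    by (simp add: realification_def block_fourier_inverse Re)
  show "realification n ls ` conj_pattern_vecs n ls \<subseteq> carrier_vec (n * sum_list ls)"
    by (auto intro!: carrier_vecI simp: realification_def)
  show "(\<lambda>x. mat_adjoint ?U *\<^sub>v cvec x) ` carrier_vec (n * sum_list ls) \<subseteq> conj_pattern_vecs n ls"
  proof safe
    fix x :: "real vec" assume x: "x \<in> carrier_vec (n * sum_list ls)"
    have "mat_adjoint ?U *\<^sub>v cvec x \<in> carrier_vec (n * sum_list ls)"
      by (rule carrier_vecI) simp
    then show "mat_adjoint ?U *\<^sub>v cvec x \<in> conj_pattern_vecs n ls"
      using x by (simp add: conj_pattern_vecs_iff_real[OF n] block_fourier_inverse real_vec_cvec)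
  qed
qed

section \<open>The two augmented Lagrangians agree\<close>

lemma cvec_simps:
  "conjugate (cvec x) = cvec x"
  "- cvec x = cvec (- x)"
  "dim_vec x = dim_vec y \<Longrightarrow> cvec x + cvec y = cvec (x + y)"
  "dim_vec x = dim_vec y \<Longrightarrow> cvec x - cvec y = cvec (x - y)"
  "dim_vec x = dim_vec y \<Longrightarrow> cvec x \<bullet> cvec y = complex_of_real (x \<bullet> y)"
  by (simp_all only: vec_eq_iff) (simp_all add: scalar_prod_def)

lemma cmat_mult_cvec:
  assumes "A \<in> carrier_mat m k" "x \<in> carrier_vec k"
  shows "cmat A *\<^sub>v cvec x = cvec (A *\<^sub>v x)"
  using assms by (auto simp: vec_eq_iff scalar_prod_def)

lemma sq_norm2_eq_scalar_prod:
  fixes x :: "complex vec"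
  shows "complex_of_real (sq_norm2 x) = conjugate x \<bullet> x"
  by (simp add: sq_norm2_def scalar_prod_def atLeast0LessThan complex_norm_square mult_ac
      del: of_real_power)

lemma sq_norm2_cvec: "sq_norm2 (cvec x) = sq_norm2 x"
  by (simp add: sq_norm2_def)

lemma sq_norm2_block_fourier:
  assumes x: "x \<in> carrier_vec (n * sum_list ls)"
  shows "sq_norm2 (block_fourier n ls *\<^sub>v x) = sq_norm2 x"
proof -
  let ?U = "block_fourier n ls"
  have "conjugate (?U *\<^sub>v x) \<bullet> (?U *\<^sub>v x) = conjugate x \<bullet> (mat_adjoint ?U *\<^sub>v (?U *\<^sub>v x))"
    by (rule conjugate_adjoint_scalar_prod[OF block_fourier_carrier x, symmetric])
      (rule carrier_vecI, simp)
  also have "\<dots> = conjugate x \<bullet> x"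
    by (simp add: block_fourier_inverse[OF x])
  finally have "complex_of_real (sq_norm2 (?U *\<^sub>v x)) = complex_of_real (sq_norm2 x)"
    by (simp only: sq_norm2_eq_scalar_prod)
  then show ?thesis by simp
qed

text \<open>The transformed matrix acts on transformed coordinates as the original matrix acts on the
  original ones.\<close>

lemma sandwich_mult_vec:
  fixes A :: "complex mat"
  assumes A: "A \<in> carrier_mat (n * sum_list ks) (n * sum_list ls)"
    and x: "x \<in> carrier_vec (n * sum_list ls)"
  shows "block_fourier n ks *\<^sub>v
      ((mat_adjoint (block_fourier n ks) * A * block_fourier n ls) *\<^sub>v x)
    = A *\<^sub>v (block_fourier n ls *\<^sub>v x)"
proof -
  let ?U = "block_fourier n ks" and ?V = "block_fourier n ls"
  have U: "mat_adjoint ?U \<in> carrier_mat (n * sum_list ks) (n * sum_list ks)" by simp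
  have Vx: "?V *\<^sub>v x \<in> carrier_vec (n * sum_list ls)"
    by (rule mult_mat_vec_carrier[OF block_fourier_carrier x])
  have "(mat_adjoint ?U * A * ?V) *\<^sub>v x = mat_adjoint ?U *\<^sub>v (A *\<^sub>v (?V *\<^sub>v x))"
    by (simp only: assoc_mult_mat_vec[OF mult_carrier_mat[OF U A] block_fourier_carrier x]
        assoc_mult_mat_vec[OF U A Vx])
  then show ?thesis
    using mult_mat_vec_carrier[OF A Vx] by (simp add: block_fourier_inverse)
qed

lemma conjugate_scalar_prod_block_fourier:
  assumes x: "x \<in> carrier_vec (n * sum_list ls)" and y: "y \<in> carrier_vec (n * sum_list ls)"
  shows "conjugate (block_fourier n ls *\<^sub>v x) \<bullet> (block_fourier n ls *\<^sub>v y) = conjugate x \<bullet> y"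
  using conjugate_adjoint_scalar_prod[OF block_fourier_carrier x, of "block_fourier n ls *\<^sub>v y"]
    mult_mat_vec_carrier[OF block_fourier_carrier y] block_fourier_inverse(1)[OF y]
  by simp

text \<open>The transformed residual is \<open>\<psi>\<^sub>v\<^sup>H (K z - v)\<close>, so inner products and the norm in the terms
  containing it are those of \<open>K z - v\<close> by unitarity; the quadratic and the linear term are treated
  alike, and the bound terms contain \<open>\<psi>\<^sub>v vt\<close> itself. In particular the Lagrangian of (D) is
  real-valued on its domain.\<close>

lemma aug_lagrangian_D_eq_aug_lagrangian:
  fixes J K :: "real mat"
  assumes n: "n > 0"
    and J: "J \<in> carrier_mat (n * sum_list lz) (n * sum_list lz)"
    and K: "K \<in> carrier_mat (n * sum_list lv) (n * sum_list lz)"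
    and q: "q \<in> carrier_vec (n * sum_list lz)"
    and bounds: "vl \<in> carrier_vec (n * sum_list lv)" "vu \<in> carrier_vec (n * sum_list lv)"
    and zt: "zt \<in> conj_pattern_vecs n lz"
    and vt: "vt \<in> conj_pattern_vecs n lv"
    and gt: "gt \<in> conj_pattern_vecs n lv"
    and m: "ml \<in> carrier_vec (n * sum_list lv)" "mu \<in> carrier_vec (n * sum_list lv)"
  defines "Uz \<equiv> block_fourier n lz" and "Uv \<equiv> block_fourier n lv"
  shows "aug_lagrangian_D \<rho> Uv (mat_adjoint Uz * cmat J * Uz) (mat_adjoint Uz *\<^sub>v cvec q)
      (mat_adjoint Uv * cmat K * Uz) vl vu (zt, vt) (gt, ml, mu)
    = complex_of_real (aug_lagrangian \<rho> J q K vl vu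
        (realification n lz zt, realification n lv vt) (realification n lv gt, ml, mu))"
proof -
  let ?Nz = "n * sum_list lz" and ?Nv = "n * sum_list lv"
  define z v g where "z = realification n lz zt" and "v = realification n lv vt"
    and "g = realification n lv gt"
  have z: "Uz *\<^sub>v zt = cvec z" and v: "Uv *\<^sub>v vt = cvec v" and g: "Uv *\<^sub>v gt = cvec g"
    using n zt vt gt by (simp_all add: Uz_def Uv_def z_def v_def g_def cvec_realification)
  have ztc: "zt \<in> carrier_vec ?Nz" and vtc: "vt \<in> carrier_vec ?Nv" and gtc: "gt \<in> carrier_vec ?Nv"
    using zt vt gt by (simp_all add: conj_pattern_vecs_def)
  have zc: "z \<in> carrier_vec ?Nz" and vc: "v \<in> carrier_vec ?Nv" and gc: "g \<in> carrier_vec ?Nv"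
    by (auto intro!: carrier_vecI simp: z_def v_def g_def realification_def)
  define Jz Kz where "Jz = (mat_adjoint Uz * cmat J * Uz) *\<^sub>v zt"
    and "Kz = (mat_adjoint Uv * cmat K * Uz) *\<^sub>v zt"
  have Jzc: "Jz \<in> carrier_vec ?Nz" and Kzc: "Kz \<in> carrier_vec ?Nv"
    by (auto intro!: carrier_vecI simp: Jz_def Kz_def Uz_def Uv_def)
  have Jz: "Uz *\<^sub>v Jz = cvec (J *\<^sub>v z)"
    unfolding Jz_def using sandwich_mult_vec[of "cmat J" n lz lz zt] J ztc z
    by (simp add: Uz_def cmat_mult_cvec[OF J zc])
  have Kz: "Uv *\<^sub>v Kz = cvec (K *\<^sub>v z)"
    unfolding Kz_def using sandwich_mult_vec[of "cmat K" n lv lz zt] K ztc z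
    by (simp add: Uz_def Uv_def cmat_mult_cvec[OF K zc])
  have res: "Uv *\<^sub>v (Kz - vt) = cvec (K *\<^sub>v z - v)"
    using mult_minus_distrib_mat_vec[of Uv ?Nv ?Nv Kz vt] Kzc vtc Kz v K vc
    by (simp add: Uv_def cvec_simps)
  have resc: "Kz - vt \<in> carrier_vec ?Nv" using Kzc vtc by simp
  have quad: "conjugate zt \<bullet> Jz = complex_of_real (z \<bullet> (J *\<^sub>v z))"
    using conjugate_scalar_prod_block_fourier[OF ztc Jzc] z Jz J zc
    by (simp add: Uz_def cvec_simps)
  have lin: "conjugate (mat_adjoint Uz *\<^sub>v cvec q) \<bullet> zt = complex_of_real (q \<bullet> z)"
  proof -
    have "mat_adjoint Uz *\<^sub>v cvec q \<in> carrier_vec ?Nz"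
      by (rule carrier_vecI) (simp add: Uz_def)
    then show ?thesis
      using conjugate_scalar_prod_block_fourier[OF _ ztc, of "mat_adjoint Uz *\<^sub>v cvec q"] q z zc
      by (simp add: Uz_def cvec_simps block_fourier_inverse)
  qed
  have eq: "conjugate gt \<bullet> (Kz - vt) = complex_of_real (g \<bullet> (K *\<^sub>v z - v))"
    using conjugate_scalar_prod_block_fourier[OF gtc resc] g res K gc vc
    by (simp add: Uv_def cvec_simps)
  have pen: "sq_norm2 (Kz - vt) = sq_norm2 (K *\<^sub>v z - v)"
    using sq_norm2_block_fourier[OF resc] res by (simp add: Uv_def sq_norm2_cvec)
  show ?thesis
    unfolding aug_lagrangian_D_def aug_lagrangian_def qp_objective_D_def qp_objective_def
    using m bounds vc
    by (simp add: quad lin eq pen v cvec_simps flip: Jz_def Kz_def z_def v_def g_def)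
qed

section \<open>Transport of saddle points\<close>

text \<open>A saddle point is defined only by comparisons of values over the two feasible sets, so it is
  preserved by bijections of these sets and by an order embedding \<open>h\<close> of the values. The
  embedding serves to compare a complex-valued function with a real-valued one.\<close>

lemma bij_betw_saddle_points:
  fixes L :: "'p \<Rightarrow> 'd \<Rightarrow> 'r :: order" and L' :: "'p' \<Rightarrow> 'd' \<Rightarrow> 's :: order"
  assumes f: "bij_betw f P P'" and g: "bij_betw g Q Q'"
    and L: "\<And>x y. x \<in> P \<Longrightarrow> y \<in> Q \<Longrightarrow> L x y = h (L' (f x) (g y))"
    and h: "\<And>a b. h a \<le> h b \<longleftrightarrow> a \<le> b"
  shows "bij_betw (map_prod f g) (saddle_points P Q L) (saddle_points P' Q' L')"
proof -
  have f': "f ` P = P'" and g': "g ` Q = Q'" using f g by (auto simp: bij_betw_def)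
  have iff: "map_prod f g w \<in> saddle_points P' Q' L' \<longleftrightarrow> w \<in> saddle_points P Q L"
    if "w \<in> P \<times> Q" for w
    using that by (auto simp: saddle_points_def f'[symmetric] g'[symmetric] L h)
  have "bij_betw (map_prod f g) (P \<times> Q) (P' \<times> Q')"
    using f g by (rule bij_betw_map_prod)
  then show ?thesis
  proof (rule bij_betw_subset)
    show sub: "saddle_points P Q L \<subseteq> P \<times> Q" by (auto simp: saddle_points_def)
    have onto: "saddle_points P' Q' L' \<subseteq> map_prod f g ` (P \<times> Q)"
      by (auto simp: saddle_points_def f'[symmetric] g'[symmetric])
    show "map_prod f g ` saddle_points P Q L = saddle_points P' Q' L'"
    proof (intro equalityI subsetI)
      fix w' assume "w' \<in> map_prod f g ` saddle_points P Q L"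
      then obtain w where w: "w' = map_prod f g w" "w \<in> saddle_points P Q L"
        by (rule imageE)
      show "w' \<in> saddle_points P' Q' L'"
        unfolding w(1) iff[OF subsetD[OF sub w(2)]] by (rule w(2))
    next
      fix w' assume w': "w' \<in> saddle_points P' Q' L'"
      from subsetD[OF onto w'] obtain w where w: "w' = map_prod f g w" "w \<in> P \<times> Q"
        by (rule imageE)
      have "w \<in> saddle_points P Q L"
        using w' unfolding w(1) iff[OF w(2)] .
      then show "w' \<in> map_prod f g ` saddle_points P Q L"
        unfolding w(1) by (rule imageI)
    qed
  qed
qed

theorem theorem3:
  fixes n :: nat and lz lv :: "nat list" and \<rho> :: real
    and J K :: "real mat" and q vl vu :: "real vec"
    and \<psi>z \<psi>v Jt Kt :: "complex mat" and qt :: "complex vec"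
  assumes "cbcqp n lz lv J q K vl vu"
    and "\<rho> > 0"
    and "\<psi>z = block_fourier n lz"
    and "\<psi>v = block_fourier n lv"
    and "qt = mat_adjoint \<psi>z *\<^sub>v cvec q"
    and "Jt = mat_adjoint \<psi>z * cmat J * \<psi>z"
    and "Kt = mat_adjoint \<psi>v * cmat K * \<psi>z"
  shows "bij_betw
    (\<lambda>((zt, vt), (gt, mlt, mut)). ((\<psi>z *\<^sub>v zt, \<psi>v *\<^sub>v vt), (\<psi>v *\<^sub>v gt, mlt, mut)))
    (optimizers_D n lz lv \<rho> \<psi>v Jt qt Kt vl vu)
    ((\<lambda>((z, v), (g, ml, mu)). ((cvec z, cvec v), (cvec g, ml, mu))) `
       optimizers_O n lz lv \<rho> J q K vl vu)"
proof -
  let ?Rz = "realification n lz" and ?Rv = "realification n lv"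
  let ?embed = "\<lambda>((z, v), (g, ml :: real vec, mu :: real vec)). ((cvec z, cvec v), (cvec g, ml, mu))"
  have n: "n > 0" using assms(1) by (simp add: cbcqp_def)
  note data = assms(1)[unfolded cbcqp_def segwise_block_circulant_def]
  have L: "aug_lagrangian_D \<rho> \<psi>v Jt qt Kt vl vu x y
      = complex_of_real (aug_lagrangian \<rho> J q K vl vu (map_prod ?Rz ?Rv x)
          (map_prod ?Rv (map_prod id id) y))"
    if "x \<in> conj_pattern_vecs n lz \<times> conj_pattern_vecs n lv"
      "y \<in> conj_pattern_vecs n lv \<times> nonneg_vecs (n * sum_list lv) \<times> nonneg_vecs (n * sum_list lv)"
    for x y
    using that aug_lagrangian_D_eq_aug_lagrangian[of n J lz K lv q vl vu "fst x" "snd x" "fst y"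
        "fst (snd y)" "snd (snd y)" \<rho>] data
    unfolding assms(3-7) by (auto simp: nonneg_vecs_def)
  have real: "bij_betw (map_prod (map_prod ?Rz ?Rv) (map_prod ?Rv (map_prod id id)))
      (optimizers_D n lz lv \<rho> \<psi>v Jt qt Kt vl vu) (optimizers_O n lz lv \<rho> J q K vl vu)"
    unfolding optimizers_D_def optimizers_O_def
    by (rule bij_betw_saddle_points[where h = complex_of_real])
      (auto intro!: bij_betw_map_prod bij_betw_realification n L simp: less_eq_complex_def)
  \<comment> \<open>The real optimizers are finally embedded into the complex vectors, where they become the
    images under \<open>\<psi>\<close> themselves.\<close>
  have inj: "inj cvec" by (auto simp: inj_def vec_eq_iff)
  have "inj ?embed" by (rule injI) (auto dest!: injD[OF inj])
  then have "bij_betw ?embed (optimizers_O n lz lv \<rho> J q K vl vu)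
      (?embed ` optimizers_O n lz lv \<rho> J q K vl vu)"
    by (intro inj_on_imp_bij_betw) (rule inj_on_subset, auto)
  note bij_betw_trans[OF real this]
  then show ?thesis
    by (rule iffD1[OF bij_betw_cong, rotated])
      (auto simp: optimizers_D_def saddle_points_def assms(3,4) cvec_realification[OF n])
qed

end
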